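(* Let $\mathcal{H}=\{\boldsymbol x:\mathbb{R}^{n_\zeta}\to\mathcal{X}\}$ and let $\mathcal{D}=\bar{\mathcal{D}}(\bar F,\alpha)$ be the nested CVaR ambiguity set with respect to a discrete distribution $\bar F$. Then the problem $$\max_{\boldsymbol x(\cdot)\in\mathcal{H},\,\gamma}\ \gamma\quad\text{subject to}\quad Q(\boldsymbol x(\cdot),\gamma)\le 0,\quad 0\le\gamma\le1,$$ with $$Q(\boldsymbol x(\cdot),\gamma):=\sup_{F\in\mathcal{D}}\ \mathbb{E}_F\Big[h(\boldsymbol x(\boldsymbol\zeta),\boldsymbol\xi)-\Big((1-\gamma)h(\bar{\boldsymbol x},\boldsymbol\xi)+\gamma\min_{\boldsymbol x'\in\mathcal{X}}h(\boldsymbol x',\boldsymbol\xi)\Big)\Big],$$ can be reformulated (same optimal value $\gamma$) as $$\max_{\gamma}\ \gamma\quad\text{subject to}\quad \sum_{\omega\in\Omega_\zeta}\mathbb{P}_{\bar F}(\boldsymbol\zeta=\boldsymbol\zeta_\omega)\,\phi_\omega(\gamma)\le 0,\quad 0\le\gamma\le 1,$$ where, for each $\omega\in\Omega_\zeta$, $\phi_\omega(\gamma)$ is a non-decreasing function (when $\bar{\boldsymbol x}\in\mathcal{X}$) equal to the optimal value of $$\min_{\boldsymbol x\in\mathcal{X},\,t\in\mathbb{R},\,\boldsymbol s\ge 0}\ t+\frac{1}{1-\alpha}\sum_{\omega'\in\Omega_\xi}\mathbb{P}_{\bar F}(\boldsymbol\xi=\boldsymbol\xi_{\omega'}\mid\boldsymbol\zeta=\boldsymbol\zeta_\omega)\,s_{\omega'}$$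 $$\text{subject to}\quad s_{\omega'}\ge h(\boldsymbol x,\boldsymbol\xi_{\omega'})-\Big((1-\gamma)h(\bar{\boldsymbol x},\boldsymbol\xi_{\omega'})+\gamma\min_{\boldsymbol x'\in\mathcal{X}}h(\boldsymbol x',\boldsymbol\xi_{\omega'})\Big)-t,\quad\forall\,\omega'\in\Omega_\xi.$$ Moreover, the latter minimization problem can be reduced to a linear program when $\mathcal{X}$ is polyhedral and $h(\boldsymbol x,\boldsymbol\xi_{\omega'})$ is linear programming representable.
   Context: Setting: $\mathcal{X}\subseteq\mathbb{R}^{n_x}$ is a convex feasible set; $h(\boldsymbol x,\boldsymbol\xi)$ is a real-valued cost function, convex in $\boldsymbol x$ for all $\boldsymbol\xi$; $\boldsymbol\xi\in\mathbb{R}^{n_\xi}$ is a random vector and $\boldsymbol\zeta\in\mathbb{R}^{n_\zeta}$ a random vector of covariates; $\bar{\boldsymbol x}$ is a reference (constant) decision with $\bar{\boldsymbol x}\in\mathcal{X}$; $\mathbb{E}_F$ and $\mathbb{P}_F$ denote expectation and probability under $F$. The minima written are assumed attained, i.e. $\min_{\boldsymbol x'\in\mathcal{X}}h(\boldsymbol x',\boldsymbol\xi)$ exists for each $\boldsymbol\xi$ and $\min_{\boldsymbol x(\cdot)\in\mathcal{H}}Q(\boldsymbol x(\cdot),\gamma)$ exists for each $\gamma\in[0,1]$. Nested CVaR ambiguity set: $\bar F$ is a discrete distribution with finite sets $\{\boldsymbol\zeta_\omega\}_{\omega\in\Omega_\zeta}$ and $\{\boldsymbol\xi_\omega\}_{\omega\in\Omega_\xi}$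 of distinct scenarios for $\boldsymbol\zeta$ and $\boldsymbol\xi$ respectively, with $\mathbb{P}_{\bar F}(\boldsymbol\zeta=\boldsymbol\zeta_\omega)>0$ for all $\omega\in\Omega_\zeta$; $\alpha\in[0,1)$; and, with $\mathcal{M}(\Omega_\zeta\times\Omega_\xi)$ the set of all distributions supported on $\{\boldsymbol\zeta_\omega\}_{\omega\in\Omega_\zeta}\times\{\boldsymbol\xi_\omega\}_{\omega\in\Omega_\xi}$, $$\bar{\mathcal{D}}(\bar F,\alpha):=\left\{F\in\mathcal{M}(\Omega_\zeta\times\Omega_\xi)\ \middle|\ \begin{array}{l}\mathbb{P}_F(\boldsymbol\zeta=\boldsymbol\zeta_\omega)=\mathbb{P}_{\bar F}(\boldsymbol\zeta=\boldsymbol\zeta_\omega)\ \ \forall\omega\in\Omega_\zeta,\\ \mathbb{P}_F(\boldsymbol\xi=\boldsymbol\xi_{\omega'}\mid\boldsymbol\zeta_\omega)\le\frac{1}{1-\alpha}\mathbb{P}_{\bar F}(\boldsymbol\xi=\boldsymbol\xi_{\omega'}\mid\boldsymbol\zeta_\omega)\ \ \forall\omega\in\Omega_\zeta,\ \omega'\in\Omega_\xi\end{array}\right\}.$$ A function $h(\cdot,\boldsymbol\xi_{\omega'})$ is linear programming representable if its epigraph is described by finitely many linear inequalities in $(\boldsymbol x,\text{value})$ and finitely many auxiliary variables (i.e. it is the projection of a polyhedron). *)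

theory Defs
  imports "HOL-Probability.Probability"
begin

definition nested_CVaR_set ::
  "('i \<Rightarrow> 'z) \<Rightarrow> ('j \<Rightarrow> 'k) \<Rightarrow> ('z \<times> 'k) pmf \<Rightarrow> real \<Rightarrow> ('z \<times> 'k) pmf set"
  where
  "nested_CVaR_set \<zeta> \<xi> Fbar \<alpha> =
    {F. set_pmf F \<subseteq> range \<zeta> \<times> range \<xi> \<and>
        (\<forall>\<omega>. \<P>(p in F. fst p = \<zeta> \<omega>) = \<P>(p in Fbar. fst p = \<zeta> \<omega>)) \<and>
        (\<forall>\<omega> \<omega>'. \<P>(p in F. snd p = \<xi> \<omega>' \<bar> fst p = \<zeta> \<omega>)
                 \<le> 1 / (1 - \<alpha>) * \<P>(p in Fbar. snd p = \<xi> \<omega>' \<bar> fst p = \<zeta> \<omega>))}"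

definition excess_cost ::
  "'x set \<Rightarrow> ('x \<Rightarrow> 'k \<Rightarrow> real) \<Rightarrow> 'x \<Rightarrow> real \<Rightarrow> 'x \<Rightarrow> 'k \<Rightarrow> real"
  where
  "excess_cost X h xbar \<gamma> x k =
    h x k - ((1 - \<gamma>) * h xbar k + \<gamma> * (INF x'\<in>X. h x' k))"

text \<open>
  The supremum is taken over the reals.  For the nested CVaR set of a distribution supported on
  finitely many scenarios, with \<open>0 \<le> \<alpha> < 1\<close>, it ranges over a nonempty bounded set.
\<close>

definition worst_case ::
  "('z \<times> 'k) pmf set \<Rightarrow> 'x set \<Rightarrow> ('x \<Rightarrow> 'k \<Rightarrow> real) \<Rightarrow> 'x \<Rightarrow> ('z \<Rightarrow> 'x) \<Rightarrow> real \<Rightarrow> real"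
  where
  "worst_case D X h xbar x \<gamma> =
    (SUP F\<in>D. measure_pmf.expectation F (\<lambda>(z, k). excess_cost X h xbar \<gamma> (x z) k))"

definition inner_feasible ::
  "'x set \<Rightarrow> ('x \<Rightarrow> 'k \<Rightarrow> real) \<Rightarrow> 'x \<Rightarrow> ('j::finite \<Rightarrow> 'k) \<Rightarrow> real \<Rightarrow>
    ('x \<times> real \<times> (real ^ 'j)) set"
  where
  "inner_feasible X h xbar \<xi> \<gamma> =
    {(x, t, s). x \<in> X \<and>
       (\<forall>\<omega>'. 0 \<le> s $ \<omega>' \<and> s $ \<omega>' \<ge> excess_cost X h xbar \<gamma> x (\<xi> \<omega>') - t)}"

definition inner_objective ::
  "('i \<Rightarrow> 'z) \<Rightarrow> ('j::finite \<Rightarrow> 'k) \<Rightarrow> ('z \<times> 'k) pmf \<Rightarrow> real \<Rightarrow> 'i \<Rightarrow>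
    'x \<times> real \<times> (real ^ 'j) \<Rightarrow> real"
  where
  "inner_objective \<zeta> \<xi> Fbar \<alpha> \<omega> = (\<lambda>(x, t, s).
    t + 1 / (1 - \<alpha>) *
      (\<Sum>\<omega>'\<in>UNIV. \<P>(p in Fbar. snd p = \<xi> \<omega>' \<bar> fst p = \<zeta> \<omega>) * s $ \<omega>'))"

definition \<phi> ::
  "'x set \<Rightarrow> ('x \<Rightarrow> 'k \<Rightarrow> real) \<Rightarrow> 'x \<Rightarrow> ('i \<Rightarrow> 'z) \<Rightarrow> ('j::finite \<Rightarrow> 'k) \<Rightarrow>
    ('z \<times> 'k) pmf \<Rightarrow> real \<Rightarrow> 'i \<Rightarrow> real \<Rightarrow> real"
  where
  "\<phi> X h xbar \<zeta> \<xi> Fbar \<alpha> \<omega> \<gamma> =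
    (INF y\<in>inner_feasible X h xbar \<xi> \<gamma>. inner_objective \<zeta> \<xi> Fbar \<alpha> \<omega> y)"

text \<open>
  A triple \<open>(a, c, b)\<close> encodes the linear inequality \<open>a \<bullet> y + (\<Sum>j<m. c j * u j) \<le> b\<close> in the
  variables \<open>y\<close> and \<open>m\<close> auxiliary real variables \<open>u 0, \<dots>, u (m - 1)\<close>; the values of \<open>u\<close> and \<open>c\<close>
  at indices \<open>\<ge> m\<close> play no role.
\<close>

definition lin_feasible ::
  "nat \<Rightarrow> ('a::euclidean_space \<times> (nat \<Rightarrow> real) \<times> real) set \<Rightarrow> ('a \<times> (nat \<Rightarrow> real)) set"
  where
  "lin_feasible m C = {(y, u). \<forall>(a, c, b)\<in>C. a \<bullet> y + (\<Sum>j<m. c j * u j) \<le> b}"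

definition lp_representable_on :: "'a::euclidean_space set \<Rightarrow> ('a \<Rightarrow> real) \<Rightarrow> bool"
  where
  "lp_representable_on X f \<longleftrightarrow>
    (\<exists>m C. finite C \<and> epigraph X f = fst ` lin_feasible m C)"

text \<open>
  Minimizing \<open>f\<close> over \<open>S\<close> reduces to a linear program: minimize the linear form \<open>c \<bullet> y\<close> over the
  solutions \<open>(y, u)\<close> of a finite system of linear inequalities.  Feasible points correspond by
  dropping \<open>u\<close>, and objective values are preserved; merely asking for an LP with the same
  optimal value would be vacuous.
\<close>

definition reduces_to_lp :: "('a::euclidean_space \<Rightarrow> real) \<Rightarrow> 'a set \<Rightarrow> bool"
  where
  "reduces_to_lp f S \<longleftrightarrow>
    (\<exists>m C c. finite C \<and> S = fst ` lin_feasible m C \<and> (\<forall>y\<in>S. f y = c \<bullet> y))"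

end

theory Submission
  imports Defs
begin

text \<open>
  A distribution in the nested CVaR set keeps the marginal of the covariates and is otherwise free
  to choose, separately for each covariate scenario \<open>\<omega>\<close>, a conditional law whose weights are at
  most \<open>1 / (1 - \<alpha>)\<close> times the nominal ones. The worst-case expectation therefore splits into
  the marginal average of scenario-wise suprema over such weights
  (\<open>worst_case_eq_expected_cvar\<close>). Each supremum is a linear program, whose dual is the
  Rockafellar--Uryasev minimization over the threshold \<open>t\<close>; an upper quantile of the costs
  gives primal and dual solutions with equal values (\<open>cvar_strong_duality\<close>). Minimizing this dual
  jointly with the decision is the problem that defines \<open>\<phi>\<close>.

  A policy is an arbitrary function of the covariates and the scenarios are distinct, so its values
  at the scenarios can be changed one at a time. As all marginal weights are positive, a policy that
  is optimal for the average is optimal in each scenario (\<open>policy_argmin_scenariowise\<close>), so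
  the optimal policy for \<open>\<gamma>\<close> attains every \<open>\<phi>\<close> simultaneously and the least worst case equals
  the marginal average of the \<open>\<phi>\<close>. Hence both problems admit exactly the same \<open>\<gamma>\<close>.

  That a largest such \<open>\<gamma>\<close> exists follows from compactness. Increasing \<open>\<gamma>\<close> by \<open>\<delta>\<close> raises each
  excess cost by \<open>\<delta>\<close> times the nonnegative gap between the cost of the reference decision and the
  minimal cost. So \<open>\<phi>\<close> is non-decreasing and Lipschitz, and \<open>\<gamma> = 0\<close> is admissible because the
  reference decision then has excess cost zero.

  For the linear program, the constraints of the inner problem say that affine images of \<open>(x, t, s)\<close>
  lie in the epigraphs of the cost functions, together with \<open>s \<ge> 0\<close>. Projections of finite linear
  systems are closed under affine preimages and finite intersections (\<open>lp_set_affine_vimage\<close>,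
  \<open>lp_set_INT\<close>).
\<close>

section \<open>Duality for the conditional value at risk\<close>

definition cvar_weights :: "real \<Rightarrow> ('j::finite \<Rightarrow> real) \<Rightarrow> ('j \<Rightarrow> real) set" where
  "cvar_weights \<alpha> q = {r. (\<Sum>j\<in>UNIV. r j) = 1 \<and> (\<forall>j. 0 \<le> r j \<and> r j \<le> 1 / (1 - \<alpha>) * q j)}"

text \<open>The dual objective of Rockafellar and Uryasev; \<open>t\<close> is the multiplier of \<open>\<Sum>j. r j = 1\<close>.\<close>

definition ru_objective :: "real \<Rightarrow> ('j::finite \<Rightarrow> real) \<Rightarrow> ('j \<Rightarrow> real) \<Rightarrow> real \<Rightarrow> real" where
  "ru_objective \<alpha> q c t = t + 1 / (1 - \<alpha>) * (\<Sum>j\<in>UNIV. q j * max 0 (c j - t))"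

definition cvar :: "real \<Rightarrow> ('j::finite \<Rightarrow> real) \<Rightarrow> ('j \<Rightarrow> real) \<Rightarrow> real" where
  "cvar \<alpha> q c = (INF t. ru_objective \<alpha> q c t)"

text \<open>
  As the weights sum to one, \<open>t\<close> can be split off each cost. The negative remainders \<open>c j - t\<close> may be
  dropped, and the positive ones receive at most the maximal weight.
\<close>

lemma cvar_weak_duality:
  assumes "r \<in> cvar_weights \<alpha> q"
  shows "(\<Sum>j\<in>UNIV. r j * c j) \<le> ru_objective \<alpha> q c t"
proof -
  have r: "(\<Sum>j\<in>UNIV. r j) = 1" "\<And>j. 0 \<le> r j" "\<And>j. r j \<le> 1 / (1 - \<alpha>) * q j"
    using assms by (auto simp: cvar_weights_def)
  have "(\<Sum>j\<in>UNIV. r j * c j) = t * (\<Sum>j\<in>UNIV. r j) + (\<Sum>j\<in>UNIV. r j * (c j - t))"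
    by (simp add: sum_distrib_left sum.distrib [symmetric] algebra_simps)
  also have "\<dots> \<le> t * (\<Sum>j\<in>UNIV. r j) + (\<Sum>j\<in>UNIV. 1 / (1 - \<alpha>) * q j * max 0 (c j - t))"
  proof (intro add_left_mono sum_mono)
    fix j
    have "r j * (c j - t) \<le> r j * max 0 (c j - t)"
      using r(2) by (intro mult_left_mono) auto
    also have "\<dots> \<le> 1 / (1 - \<alpha>) * q j * max 0 (c j - t)"
      using r(3) by (intro mult_right_mono) auto
    finally show "r j * (c j - t) \<le> 1 / (1 - \<alpha>) * q j * max 0 (c j - t)" .
  qed
  also have "\<dots> = ru_objective \<alpha> q c t"
    using r(1) by (simp add: ru_objective_def sum_distrib_left mult.assoc)
  finally show ?thesis .
qed

text \<open>
  Taking the least value of \<open>c\<close> whose strict upper tail has mass at most \<open>\<beta>\<close> works: the weak upper tail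
  of that value is everything or the strict upper tail of the next smaller
  value, which has mass more than \<open>\<beta>\<close> by minimality.
\<close>

lemma exists_upper_quantile:
  fixes q c :: "'j::finite \<Rightarrow> real"
  assumes q: "\<And>j. 0 \<le> q j" and \<beta>: "0 \<le> \<beta>" "\<beta> \<le> (\<Sum>j\<in>UNIV. q j)"
  obtains t where "(\<Sum>j | c j > t. q j) \<le> \<beta>" and "\<beta> \<le> (\<Sum>j | c j \<ge> t. q j)"
proof -
  define T where "T = {v \<in> range c. (\<Sum>j | c j > v. q j) \<le> \<beta>}"
  define t where "t = Min T"
  have "Max (range c) \<in> T"
  proof -
    have "{j. c j > Max (range c)} = {}" by (auto simp: not_less)
    then show ?thesis using \<beta> unfolding T_def by (auto intro: Max_in simp del: Max_less_iff)
  qed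
  moreover have fin: "finite T" by (simp add: T_def)
  ultimately have t: "t \<in> T" and least: "\<And>v. v \<in> T \<Longrightarrow> t \<le> v"
    unfolding t_def by (auto intro: Min_in)
  have "\<beta> \<le> (\<Sum>j | c j \<ge> t. q j)"
  proof (cases "{v \<in> range c. v < t} = {}")
    case True
    then have "{j. c j \<ge> t} = UNIV" by (auto simp: not_less)
    then show ?thesis using \<beta> by simp
  next
    case False
    define v where "v = Max {v \<in> range c. v < t}"
    have v: "v \<in> range c" "v < t" using Max_in [OF _ False] by (auto simp: v_def)
    have "{j. c j > v} = {j. c j \<ge> t}"
    proof (intro Collect_cong iffI)
      fix j assume "c j > v"
      show "c j \<ge> t"
      proof (rule ccontr)
        assume "\<not> c j \<ge> t"
        then have "c j \<le> v" unfolding v_def by (intro Max_ge) auto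
        with \<open>c j > v\<close> show False by simp
      qed
    qed (use v in auto)
    moreover have "v \<notin> T" using least v by force
    ultimately show ?thesis using v by (simp add: T_def)
  qed
  with t show ?thesis by (intro that [of t]) (auto simp: T_def)
qed

text \<open>
  The optimal weights fill the maximal density \<open>1 / (1 - \<alpha>)\<close> from the highest cost downwards until
  the total mass is one. At the quantile \<open>t\<close>, where the mass runs out, only a fraction \<open>\<kappa>\<close> of the
  density is used. The values agree because costs equal to \<open>t\<close> contribute nothing to the
  dual sum.
\<close>

lemma cvar_strong_duality:
  assumes \<alpha>: "0 \<le> \<alpha>" "\<alpha> < 1" and q: "\<And>j. 0 \<le> q j" "(\<Sum>j\<in>UNIV. q j) = 1"
  obtains t r where "r \<in> cvar_weights \<alpha> q"
    and "(\<Sum>j\<in>UNIV. r j * c j) = ru_objective \<alpha> q c t"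
proof -
  define \<beta> where "\<beta> = 1 - \<alpha>"
  have \<beta>: "0 < \<beta>" "\<beta> \<le> 1" using \<alpha> by (auto simp: \<beta>_def)
  obtain t where t: "(\<Sum>j | c j > t. q j) \<le> \<beta>" "\<beta> \<le> (\<Sum>j | c j \<ge> t. q j)"
    using exists_upper_quantile [of q \<beta> c] q \<beta> by auto
  define A B where "A = {j. c j > t}" and "B = {j. c j = t}"
  have AB: "{j. c j \<ge> t} = A \<union> B" "A \<inter> B = {}" by (auto simp: A_def B_def)
  have le: "sum q A \<le> \<beta>" "\<beta> \<le> sum q A + sum q B"
    using t AB by (auto simp: A_def [symmetric] sum.union_disjoint)
  \<comment> \<open>If \<open>B\<close> has mass zero then so does the numerator, and the value 0 of the quotient is correct.\<close>
  define \<kappa> where "\<kappa> = (\<beta> - sum q A) / sum q B"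
  have B0: "0 \<le> sum q B" by (simp add: q sum_nonneg)
  have \<kappa>: "0 \<le> \<kappa>" "\<kappa> \<le> 1" "\<kappa> * sum q B = \<beta> - sum q A"
    using le B0 by (cases "sum q B = 0"; simp add: \<kappa>_def divide_simps)+
  define r where "r j = (if j \<in> A then q j / \<beta> else if j \<in> B then \<kappa> * q j / \<beta> else 0)" for j
  have r_sum: "(\<Sum>j\<in>UNIV. r j * f j)
      = (\<Sum>j\<in>A. q j * f j) / \<beta> + \<kappa> * (\<Sum>j\<in>B. q j * f j) / \<beta>" for f
  proof -
    have "(\<Sum>j\<in>UNIV. r j * f j) = (\<Sum>j\<in>A \<union> B. r j * f j)"
      by (rule sum.mono_neutral_right) (auto simp: r_def)
    also have "\<dots> = (\<Sum>j\<in>A. r j * f j) + (\<Sum>j\<in>B. r j * f j)"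
      using AB by (intro sum.union_disjoint) auto
    also have "(\<Sum>j\<in>A. r j * f j) = (\<Sum>j\<in>A. q j * f j / \<beta>)"
      by (rule sum.cong) (auto simp: r_def)
    also have "(\<Sum>j\<in>B. r j * f j) = (\<Sum>j\<in>B. \<kappa> * (q j * f j) / \<beta>)"
      using AB by (intro sum.cong) (auto simp: r_def)
    finally show ?thesis by (simp add: sum_divide_distrib sum_distrib_left)
  qed
  show ?thesis
  proof
    have "(\<Sum>j\<in>UNIV. r j) = 1"
      using r_sum [of "\<lambda>_. 1"] \<kappa>(3) \<beta> by (simp add: field_simps)
    moreover have "0 \<le> r j \<and> r j \<le> 1 / (1 - \<alpha>) * q j" for j
      using q(1) [of j] \<kappa> \<beta> mult_right_mono [OF \<kappa>(2) q(1)]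
      by (auto simp: r_def \<beta>_def [symmetric] divide_simps)
    ultimately show "r \<in> cvar_weights \<alpha> q" by (simp add: cvar_weights_def)
    have "(\<Sum>j\<in>UNIV. q j * max 0 (c j - t)) = (\<Sum>j\<in>A. q j * (c j - t))"
    proof -
      have "(\<Sum>j\<in>UNIV. q j * max 0 (c j - t)) = (\<Sum>j\<in>A. q j * max 0 (c j - t))"
        by (rule sum.mono_neutral_right) (auto simp: A_def)
      also have "\<dots> = (\<Sum>j\<in>A. q j * (c j - t))"
        by (rule sum.cong) (auto simp: A_def)
      finally show ?thesis .
    qed
    also have "\<dots> = (\<Sum>j\<in>A. q j * c j) - t * sum q A"
      by (simp add: right_diff_distrib sum_subtractf sum_distrib_left mult.commute)
    finally have "ru_objective \<alpha> q c t = t + ((\<Sum>j\<in>A. q j * c j) - t * sum q A) / \<beta>"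
      by (simp add: ru_objective_def \<beta>_def)
    moreover have "(\<Sum>j\<in>B. q j * c j) = t * sum q B"
      by (simp add: B_def sum_distrib_left mult.commute)
    then have "(\<Sum>j\<in>UNIV. r j * c j) = (\<Sum>j\<in>A. q j * c j) / \<beta> + t * (\<kappa> * sum q B) / \<beta>"
      unfolding r_sum by (simp add: mult.left_commute)
    moreover have "(\<Sum>j\<in>A. q j * c j) / \<beta> + t * (\<beta> - sum q A) / \<beta>
        = t + ((\<Sum>j\<in>A. q j * c j) - t * sum q A) / \<beta>"
      using \<beta> by (simp add: field_simps)
    ultimately show "(\<Sum>j\<in>UNIV. r j * c j) = ru_objective \<alpha> q c t"
      by (simp only: \<kappa>(3))
  qed
qed

lemma cvar_attained:
  assumes "0 \<le> \<alpha>" "\<alpha> < 1" "\<And>j. 0 \<le> q j" "(\<Sum>j\<in>UNIV. q j) = 1"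
  obtains t r where "cvar \<alpha> q c = ru_objective \<alpha> q c t" and "r \<in> cvar_weights \<alpha> q"
    and "cvar \<alpha> q c = (\<Sum>j\<in>UNIV. r j * c j)"
proof -
  obtain t r where r: "r \<in> cvar_weights \<alpha> q"
      and eq: "(\<Sum>j\<in>UNIV. r j * c j) = ru_objective \<alpha> q c t"
    by (rule cvar_strong_duality [OF assms])
  have "ru_objective \<alpha> q c t \<le> ru_objective \<alpha> q c t'" for t'
    using cvar_weak_duality [OF r, of c t'] eq by simp
  then have "cvar \<alpha> q c = ru_objective \<alpha> q c t"
    unfolding cvar_def by (intro cInf_eq_minimum) auto
  with r eq show ?thesis by (intro that [of t r]) simp_all
qed

lemma cvar_le_ru_objective:
  assumes "r \<in> cvar_weights \<alpha> q"
  shows "cvar \<alpha> q c \<le> ru_objective \<alpha> q c t"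
  unfolding cvar_def using cvar_weak_duality [OF assms]
  by (intro cINF_lower bdd_belowI2) auto

section \<open>The nested ambiguity set\<close>

lemma finite_scenario_expectation:
  fixes \<zeta> :: "'i::finite \<Rightarrow> 'z" and \<xi> :: "'j::finite \<Rightarrow> 'k" and f :: "'z \<times> 'k \<Rightarrow> real"
  assumes "inj \<zeta>" "inj \<xi>" "set_pmf F \<subseteq> range \<zeta> \<times> range \<xi>"
  shows "measure_pmf.expectation F f = (\<Sum>\<omega>\<in>UNIV. \<Sum>j\<in>UNIV. pmf F (\<zeta> \<omega>, \<xi> j) * f (\<zeta> \<omega>, \<xi> j))"
proof -
  have "measure_pmf.expectation F f = (\<Sum>p\<in>range \<zeta> \<times> range \<xi>. pmf F p * f p)"
    using assms(3) by (subst integral_measure_pmf_real [of "range \<zeta> \<times> range \<xi>"]) (auto simp: mult.commute)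
  also have "\<dots> = (\<Sum>z\<in>range \<zeta>. \<Sum>k\<in>range \<xi>. pmf F (z, k) * f (z, k))"
    by (simp add: sum.cartesian_product)
  also have "\<dots> = (\<Sum>\<omega>\<in>UNIV. \<Sum>j\<in>UNIV. pmf F (\<zeta> \<omega>, \<xi> j) * f (\<zeta> \<omega>, \<xi> j))"
    using assms by (simp add: sum.reindex)
  finally show ?thesis .
qed

lemma finite_scenario_marginal:
  fixes \<zeta> :: "'i::finite \<Rightarrow> 'z" and \<xi> :: "'j::finite \<Rightarrow> 'k"
  assumes "inj \<xi>" "set_pmf F \<subseteq> range \<zeta> \<times> range \<xi>"
  shows "\<P>(p in measure_pmf F. fst p = \<zeta> \<omega>) = (\<Sum>j\<in>UNIV. pmf F (\<zeta> \<omega>, \<xi> j))"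
proof -
  have "\<P>(p in measure_pmf F. fst p = \<zeta> \<omega>) = measure_pmf.prob F ((\<lambda>j. (\<zeta> \<omega>, \<xi> j)) ` UNIV)"
    using assms(2) by (intro measure_pmf.finite_measure_eq_AE) (auto simp: AE_measure_pmf_iff)
  also have "\<dots> = (\<Sum>j\<in>UNIV. pmf F (\<zeta> \<omega>, \<xi> j))"
    using assms(1) by (subst measure_measure_pmf_finite) (auto simp: sum.reindex inj_on_def)
  finally show ?thesis .
qed

lemma cond_prob_pmf_pair:
  "\<P>(p in measure_pmf F. snd p = k \<bar> fst p = z) = pmf F (z, k) / \<P>(p in measure_pmf F. fst p = z)"
proof -
  have "{p. snd p = k \<and> fst p = z} = {(z, k)}" by auto
  then show ?thesis by (simp add: cond_prob_def pmf.rep_eq)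
qed

locale nested_scenarios =
  fixes \<zeta> :: "'i::finite \<Rightarrow> 'z" and \<xi> :: "'j::finite \<Rightarrow> 'k"
    and Fbar :: "('z \<times> 'k) pmf" and \<alpha> :: real
  assumes inj_\<zeta>: "inj \<zeta>" and inj_\<xi>: "inj \<xi>"
    and support: "set_pmf Fbar \<subseteq> range \<zeta> \<times> range \<xi>"
    and marginal_pos: "\<And>\<omega>. \<P>(p in measure_pmf Fbar. fst p = \<zeta> \<omega>) > 0"
    and \<alpha>: "0 \<le> \<alpha>" "\<alpha> < 1"
begin

definition marginal :: "'i \<Rightarrow> real" where
  "marginal \<omega> = \<P>(p in measure_pmf Fbar. fst p = \<zeta> \<omega>)"

definition conditional :: "'i \<Rightarrow> 'j \<Rightarrow> real" where
  "conditional \<omega> j = \<P>(p in measure_pmf Fbar. snd p = \<xi> j \<bar> fst p = \<zeta> \<omega>)"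

lemma marginal_gt_0: "0 < marginal \<omega>"
  using marginal_pos by (simp add: marginal_def)

lemma marginal_nonneg [simp]: "0 \<le> marginal \<omega>"
  using marginal_gt_0 less_imp_le by blast

lemma marginal_eq_sum: "marginal \<omega> = (\<Sum>j\<in>UNIV. pmf Fbar (\<zeta> \<omega>, \<xi> j))"
  unfolding marginal_def by (rule finite_scenario_marginal [OF inj_\<xi> support])

lemma conditional_eq: "conditional \<omega> j = pmf Fbar (\<zeta> \<omega>, \<xi> j) / marginal \<omega>"
  unfolding conditional_def marginal_def by (rule cond_prob_pmf_pair)

lemma conditional_nonneg [simp]: "0 \<le> conditional \<omega> j"
  by (simp add: conditional_eq)

lemma sum_conditional: "(\<Sum>j\<in>UNIV. conditional \<omega> j) = 1"
  using marginal_gt_0 [of \<omega>]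
  by (simp add: conditional_eq sum_divide_distrib [symmetric] marginal_eq_sum)

lemma sum_marginal: "(\<Sum>\<omega>\<in>UNIV. marginal \<omega>) = 1"
  using finite_scenario_expectation [OF inj_\<zeta> inj_\<xi> support, of "\<lambda>_. 1"]
  by (simp add: marginal_eq_sum)

lemma mem_nested_CVaR_set_iff:
  "F \<in> nested_CVaR_set \<zeta> \<xi> Fbar \<alpha> \<longleftrightarrow> set_pmf F \<subseteq> range \<zeta> \<times> range \<xi> \<and>
    (\<forall>\<omega>. (\<Sum>j\<in>UNIV. pmf F (\<zeta> \<omega>, \<xi> j)) = marginal \<omega> \<and>
      (\<forall>j. pmf F (\<zeta> \<omega>, \<xi> j) / marginal \<omega> \<le> 1 / (1 - \<alpha>) * conditional \<omega> j))"
proof (cases "set_pmf F \<subseteq> range \<zeta> \<times> range \<xi>")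
  case True
  show ?thesis
    unfolding nested_CVaR_set_def mem_Collect_eq cond_prob_pmf_pair [of F]
      finite_scenario_marginal [OF inj_\<xi> True] marginal_def [symmetric]
      conditional_def [symmetric]
    by (auto simp del: times_divide_eq_left)
qed (simp add: nested_CVaR_set_def)

lemma expectation_nested_CVaR_set:
  assumes "F \<in> nested_CVaR_set \<zeta> \<xi> Fbar \<alpha>"
  obtains r where "\<And>\<omega>. r \<omega> \<in> cvar_weights \<alpha> (conditional \<omega>)"
    and "\<And>f. measure_pmf.expectation F f = (\<Sum>\<omega>\<in>UNIV. marginal \<omega> * (\<Sum>j\<in>UNIV. r \<omega> j * f (\<zeta> \<omega>, \<xi> j)))"
proof -
  have F: "set_pmf F \<subseteq> range \<zeta> \<times> range \<xi>" "\<And>\<omega>. (\<Sum>j\<in>UNIV. pmf F (\<zeta> \<omega>, \<xi> j)) = marginal \<omega>"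
      "\<And>\<omega> j. pmf F (\<zeta> \<omega>, \<xi> j) / marginal \<omega> \<le> 1 / (1 - \<alpha>) * conditional \<omega> j"
    using assms unfolding mem_nested_CVaR_set_iff by blast+
  define r where "r \<omega> j = pmf F (\<zeta> \<omega>, \<xi> j) / marginal \<omega>" for \<omega> j
  have mr: "pmf F (\<zeta> \<omega>, \<xi> j) = marginal \<omega> * r \<omega> j" for \<omega> j
    using marginal_gt_0 [of \<omega>] by (simp add: r_def)
  show ?thesis
  proof
    fix \<omega>
    have "(\<Sum>j\<in>UNIV. r \<omega> j) = 1"
      using F(2) [of \<omega>] marginal_gt_0 [of \<omega>] by (simp add: r_def sum_divide_distrib [symmetric])
    moreover have "r \<omega> j \<le> 1 / (1 - \<alpha>) * conditional \<omega> j" for j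
      unfolding r_def by (rule F(3))
    ultimately show "r \<omega> \<in> cvar_weights \<alpha> (conditional \<omega>)"
      by (simp add: cvar_weights_def r_def)
  next
    fix f
    show "measure_pmf.expectation F f = (\<Sum>\<omega>\<in>UNIV. marginal \<omega> * (\<Sum>j\<in>UNIV. r \<omega> j * f (\<zeta> \<omega>, \<xi> j)))"
      by (simp add: finite_scenario_expectation [OF inj_\<zeta> inj_\<xi> F(1)] sum_distrib_left
          mr mult.assoc)
  qed
qed

text \<open>
  The converse of the disintegration above: the marginal of \<open>Fbar\<close> and arbitrary admissible
  conditional weights can be glued together. This is the rectangularity that decouples the scenarios.
\<close>

lemma nested_CVaR_set_realizes_weights:
  assumes r: "\<And>\<omega>. r \<omega> \<in> cvar_weights \<alpha> (conditional \<omega>)"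
  obtains F where "F \<in> nested_CVaR_set \<zeta> \<xi> Fbar \<alpha>"
    and "\<And>f. measure_pmf.expectation F f = (\<Sum>\<omega>\<in>UNIV. marginal \<omega> * (\<Sum>j\<in>UNIV. r \<omega> j * f (\<zeta> \<omega>, \<xi> j)))"
proof -
  have r: "\<And>\<omega>. (\<Sum>j\<in>UNIV. r \<omega> j) = 1" "\<And>\<omega> j. 0 \<le> r \<omega> j"
      "\<And>\<omega> j. r \<omega> j \<le> 1 / (1 - \<alpha>) * conditional \<omega> j"
    using assms by (auto simp: cvar_weights_def)
  define w where "w = (\<lambda>(\<omega>, j). marginal \<omega> * r \<omega> j)"
  have w0: "0 \<le> w p" for p by (auto simp: w_def r split: prod.split)
  have "(\<Sum>p\<in>UNIV. w p) = (\<Sum>\<omega>\<in>UNIV. \<Sum>j\<in>UNIV. marginal \<omega> * r \<omega> j)"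
    by (simp add: w_def sum.cartesian_product)
  also have "\<dots> = 1"
    by (simp add: sum_distrib_left [symmetric] r sum_marginal)
  finally have "(\<Sum>p\<in>UNIV. w p) = 1" .
  then have w1: "(\<integral>\<^sup>+ p. ennreal (w p) \<partial>count_space UNIV) = 1"
    using w0 by (simp add: nn_integral_count_space_finite sum_ennreal)
  define F where "F = map_pmf (map_prod \<zeta> \<xi>) (embed_pmf w)"
  have supp: "set_pmf F \<subseteq> range \<zeta> \<times> range \<xi>" by (auto simp: F_def)
  have pmfF: "pmf F (\<zeta> \<omega>, \<xi> j) = marginal \<omega> * r \<omega> j" for \<omega> j
  proof -
    have "pmf F (map_prod \<zeta> \<xi> (\<omega>, j)) = pmf (embed_pmf w) (\<omega>, j)"
      unfolding F_def using inj_\<zeta> inj_\<xi> by (intro pmf_map_inj' prod.inj_map)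
    then show ?thesis by (simp add: pmf_embed_pmf [OF w0 w1]) (simp add: w_def)
  qed
  show ?thesis
  proof
    have "pmf F (\<zeta> \<omega>, \<xi> j) / marginal \<omega> \<le> 1 / (1 - \<alpha>) * conditional \<omega> j" for \<omega> j
      using r(3) [of \<omega> j] marginal_gt_0 [of \<omega>] by (simp add: pmfF)
    then show "F \<in> nested_CVaR_set \<zeta> \<xi> Fbar \<alpha>"
      unfolding mem_nested_CVaR_set_iff using supp
      by (simp add: pmfF sum_distrib_left [symmetric] r)
    show "measure_pmf.expectation F f = (\<Sum>\<omega>\<in>UNIV. marginal \<omega> * (\<Sum>j\<in>UNIV. r \<omega> j * f (\<zeta> \<omega>, \<xi> j)))" for f
      by (simp add: finite_scenario_expectation [OF inj_\<zeta> inj_\<xi> supp] pmfF sum_distrib_left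
          mult.assoc)
  qed
qed

text \<open>
  Gluing the scenario-wise optimal weights gives a member of the ambiguity set that attains the
  supremum in all scenarios at once.
\<close>

lemma worst_case_eq_expected_cvar:
  "worst_case (nested_CVaR_set \<zeta> \<xi> Fbar \<alpha>) X h xbar x \<gamma> =
    (\<Sum>\<omega>\<in>UNIV. marginal \<omega> *
      cvar \<alpha> (conditional \<omega>) (\<lambda>j. excess_cost X h xbar \<gamma> (x (\<zeta> \<omega>)) (\<xi> j)))"
proof -
  let ?c = "\<lambda>\<omega> j. excess_cost X h xbar \<gamma> (x (\<zeta> \<omega>)) (\<xi> j)"
  let ?E = "\<lambda>F. measure_pmf.expectation F (\<lambda>(z, k). excess_cost X h xbar \<gamma> (x z) k)"
  have "\<exists>r. r \<in> cvar_weights \<alpha> (conditional \<omega>) \<and>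
      cvar \<alpha> (conditional \<omega>) (?c \<omega>) = (\<Sum>j\<in>UNIV. r j * ?c \<omega> j)" for \<omega>
    by (rule cvar_attained [OF \<alpha> conditional_nonneg sum_conditional, where c = "?c \<omega>"]) blast
  then obtain r where r: "\<And>\<omega>. r \<omega> \<in> cvar_weights \<alpha> (conditional \<omega>)"
      "\<And>\<omega>. cvar \<alpha> (conditional \<omega>) (?c \<omega>) = (\<Sum>j\<in>UNIV. r \<omega> j * ?c \<omega> j)"
    by metis
  obtain F where F: "F \<in> nested_CVaR_set \<zeta> \<xi> Fbar \<alpha>"
    and EF: "\<And>f. measure_pmf.expectation F f
      = (\<Sum>\<omega>\<in>UNIV. marginal \<omega> * (\<Sum>j\<in>UNIV. r \<omega> j * f (\<zeta> \<omega>, \<xi> j)))"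
    using nested_CVaR_set_realizes_weights [OF r(1)] by blast
  have F_opt: "?E F = (\<Sum>\<omega>\<in>UNIV. marginal \<omega> * cvar \<alpha> (conditional \<omega>) (?c \<omega>))"
    by (simp add: EF r(2))
  have "?E G \<le> (\<Sum>\<omega>\<in>UNIV. marginal \<omega> * cvar \<alpha> (conditional \<omega>) (?c \<omega>))"
    if G: "G \<in> nested_CVaR_set \<zeta> \<xi> Fbar \<alpha>" for G
  proof -
    obtain r' where r': "\<And>\<omega>. r' \<omega> \<in> cvar_weights \<alpha> (conditional \<omega>)"
      and EG: "\<And>f. measure_pmf.expectation G f
        = (\<Sum>\<omega>\<in>UNIV. marginal \<omega> * (\<Sum>j\<in>UNIV. r' \<omega> j * f (\<zeta> \<omega>, \<xi> j)))"
      using expectation_nested_CVaR_set [OF G] by blast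
    have "(\<Sum>j\<in>UNIV. r' \<omega> j * ?c \<omega> j) \<le> cvar \<alpha> (conditional \<omega>) (?c \<omega>)" for \<omega>
      unfolding cvar_def by (intro cINF_greatest cvar_weak_duality r') simp
    then show ?thesis
      by (simp add: EG) (intro sum_mono mult_left_mono marginal_nonneg)
  qed
  then show ?thesis
    unfolding worst_case_def using F F_opt by (intro cSup_eq_maximum) (auto intro: rev_image_eqI)
qed

end

section \<open>Attainable fractions of the optimal improvement\<close>

text \<open>
  The dependence on \<open>\<gamma>\<close> is affine with a slope that does not involve \<open>x\<close>; monotonicity and the
  Lipschitz bound below rest on this.
\<close>

lemma excess_cost_diff:
  "excess_cost X h xbar \<gamma>' x k =
    excess_cost X h xbar \<gamma> x k + (\<gamma>' - \<gamma>) * (h xbar k - (INF x'\<in>X. h x' k))"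
  by (simp add: excess_cost_def algebra_simps)

locale regret_problem = nested_scenarios \<zeta> \<xi> Fbar \<alpha>
  for \<zeta> :: "'i::finite \<Rightarrow> 'z" and \<xi> :: "'j::finite \<Rightarrow> 'k"
    and Fbar :: "('z \<times> 'k) pmf" and \<alpha> :: real +
  fixes X :: "'x set" and h :: "'x \<Rightarrow> 'k \<Rightarrow> real" and xbar :: 'x
  assumes xbar: "xbar \<in> X"
    and bdd: "\<And>k. bdd_below ((\<lambda>x. h x k) ` X)"
begin

abbreviation gap :: "'k \<Rightarrow> real" where
  "gap k \<equiv> h xbar k - (INF x'\<in>X. h x' k)"

abbreviation excess_cvar :: "'i \<Rightarrow> real \<Rightarrow> 'x \<Rightarrow> real" where
  "excess_cvar \<omega> \<gamma> x \<equiv> cvar \<alpha> (conditional \<omega>) (\<lambda>j. excess_cost X h xbar \<gamma> x (\<xi> j))"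

abbreviation opt_cvar :: "'i \<Rightarrow> real \<Rightarrow> real" where
  "opt_cvar \<equiv> \<phi> X h xbar \<zeta> \<xi> Fbar \<alpha>"

abbreviation feasible :: "real \<Rightarrow> ('x \<times> real \<times> (real ^ 'j)) set" where
  "feasible \<equiv> inner_feasible X h xbar \<xi>"

abbreviation objective :: "'i \<Rightarrow> 'x \<times> real \<times> (real ^ 'j) \<Rightarrow> real" where
  "objective \<equiv> inner_objective \<zeta> \<xi> Fbar \<alpha>"

lemma gap_nonneg: "0 \<le> gap k"
  using cINF_lower [OF bdd xbar] by simp

lemma excess_cost_ge: "x \<in> X \<Longrightarrow> excess_cost X h xbar \<gamma> x k \<ge> (\<gamma> - 1) * gap k"
  using cINF_lower [OF bdd, of x k] by (simp add: excess_cost_def algebra_simps)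

lemma excess_cvar_le_objective:
  assumes "(x, t, s) \<in> feasible \<gamma>"
  shows "excess_cvar \<omega> \<gamma> x \<le> objective \<omega> (x, t, s)"
proof -
  have s: "max 0 (excess_cost X h xbar \<gamma> x (\<xi> j) - t) \<le> s $ j" for j
    using assms by (auto simp: inner_feasible_def)
  have "excess_cvar \<omega> \<gamma> x
      \<le> ru_objective \<alpha> (conditional \<omega>) (\<lambda>j. excess_cost X h xbar \<gamma> x (\<xi> j)) t"
    by (rule cvar_attained [OF \<alpha> conditional_nonneg sum_conditional]) (rule cvar_le_ru_objective)
  also have "\<dots> \<le> objective \<omega> (x, t, s)"
    using s \<alpha> conditional_nonneg unfolding ru_objective_def inner_objective_def prod.case conditional_def [symmetric]
    by (intro add_left_mono mult_left_mono sum_mono) auto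
  finally show ?thesis .
qed

lemma excess_cvar_eq_objective:
  assumes "x \<in> X"
  obtains t s where "(x, t, s) \<in> feasible \<gamma>" "excess_cvar \<omega> \<gamma> x = objective \<omega> (x, t, s)"
proof -
  let ?c = "\<lambda>j. excess_cost X h xbar \<gamma> x (\<xi> j)"
  obtain t where t: "cvar \<alpha> (conditional \<omega>) ?c = ru_objective \<alpha> (conditional \<omega>) ?c t"
    by (rule cvar_attained [OF \<alpha> conditional_nonneg sum_conditional])
  show ?thesis
  proof
    show "(x, t, \<chi> j. max 0 (?c j - t)) \<in> feasible \<gamma>"
      using assms by (simp add: inner_feasible_def)
    show "excess_cvar \<omega> \<gamma> x = objective \<omega> (x, t, \<chi> j. max 0 (?c j - t))"
      unfolding t by (simp add: ru_objective_def inner_objective_def conditional_def)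
  qed
qed

lemma feasible_nonempty: "feasible \<gamma> \<noteq> {}"
  using excess_cvar_eq_objective [OF xbar] by (metis empty_iff)

text \<open>
  Since \<open>1 / (1 - \<alpha>) \<ge> 1\<close>, the objective dominates the nominal mean of \<open>t + s\<close>, hence of the excess
  cost, and the latter is bounded below uniformly in \<open>x\<close>. This makes the infimum defining \<open>\<phi>\<close>
  meaningful for every real \<open>\<gamma>\<close>, also outside the unit interval.
\<close>

lemma objective_bdd_below: "bdd_below (objective \<omega> ` feasible \<gamma>)"
proof (rule bdd_belowI2)
  fix y assume "y \<in> feasible \<gamma>"
  moreover obtain x t s where y: "y = (x, t, s)" by (cases y)
  ultimately have x: "x \<in> X" and s: "\<And>j. 0 \<le> s $ j"
      "\<And>j. excess_cost X h xbar \<gamma> x (\<xi> j) \<le> t + s $ j"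
    by (auto simp: inner_feasible_def diff_le_eq add.commute)
  have "(\<Sum>j\<in>UNIV. conditional \<omega> j * ((\<gamma> - 1) * gap (\<xi> j)))
      \<le> (\<Sum>j\<in>UNIV. conditional \<omega> j * (t + s $ j))"
    using excess_cost_ge [OF x, of \<gamma>] s(2) conditional_nonneg
    by (intro sum_mono mult_left_mono) (auto intro: order_trans)
  also have "\<dots> = t + 1 * (\<Sum>j\<in>UNIV. conditional \<omega> j * s $ j)"
    by (simp add: distrib_left sum.distrib sum_distrib_right [symmetric] sum_conditional)
  also have "\<dots> \<le> t + 1 / (1 - \<alpha>) * (\<Sum>j\<in>UNIV. conditional \<omega> j * s $ j)"
    using \<alpha> s(1) conditional_nonneg
    by (intro add_left_mono mult_right_mono sum_nonneg) auto
  finally show "(\<Sum>j\<in>UNIV. conditional \<omega> j * ((\<gamma> - 1) * gap (\<xi> j))) \<le> objective \<omega> y"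
    by (simp add: y inner_objective_def conditional_def)
qed

lemma opt_cvar_le_excess_cvar:
  assumes "x \<in> X"
  shows "opt_cvar \<omega> \<gamma> \<le> excess_cvar \<omega> \<gamma> x"
proof -
  obtain t s where "(x, t, s) \<in> feasible \<gamma>" and eq: "excess_cvar \<omega> \<gamma> x = objective \<omega> (x, t, s)"
    using excess_cvar_eq_objective [OF assms] .
  then show ?thesis
    unfolding eq \<phi>_def by (intro cINF_lower [OF objective_bdd_below])
qed

lemma opt_cvar_attained:
  assumes "x \<in> X" "\<And>x'. x' \<in> X \<Longrightarrow> excess_cvar \<omega> \<gamma> x \<le> excess_cvar \<omega> \<gamma> x'"
  obtains y where "is_arg_min (objective \<omega>) (\<lambda>y. y \<in> feasible \<gamma>) y"
    and "opt_cvar \<omega> \<gamma> = objective \<omega> y" and "opt_cvar \<omega> \<gamma> = excess_cvar \<omega> \<gamma> x"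
proof -
  obtain t s where ts: "(x, t, s) \<in> feasible \<gamma>" "excess_cvar \<omega> \<gamma> x = objective \<omega> (x, t, s)"
    using excess_cvar_eq_objective [OF assms(1)] .
  have least: "objective \<omega> (x, t, s) \<le> objective \<omega> y" if "y \<in> feasible \<gamma>" for y
  proof -
    obtain x' t' s' where y: "y = (x', t', s')" by (cases y)
    have "objective \<omega> (x, t, s) \<le> excess_cvar \<omega> \<gamma> x'"
      using assms(2) [of x'] that by (simp add: ts(2) [symmetric] y inner_feasible_def)
    also have "\<dots> \<le> objective \<omega> y"
      using excess_cvar_le_objective that by (simp add: y)
    finally show ?thesis .
  qed
  show ?thesis
  proof
    show "is_arg_min (objective \<omega>) (\<lambda>y. y \<in> feasible \<gamma>) (x, t, s)"
      using ts least by (simp add: is_arg_min_linorder)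
    show "opt_cvar \<omega> \<gamma> = objective \<omega> (x, t, s)"
      unfolding \<phi>_def using ts least by (intro cInf_eq_minimum) auto
    with ts show "opt_cvar \<omega> \<gamma> = excess_cvar \<omega> \<gamma> x" by simp
  qed
qed

text \<open>
  A larger \<open>\<gamma>\<close> tightens the constraints and leaves the objective unchanged.
\<close>

lemma opt_cvar_mono: "mono (opt_cvar \<omega>)"
proof (rule monoI)
  fix \<gamma> \<gamma>' :: real assume le: "\<gamma> \<le> \<gamma>'"
  have "excess_cost X h xbar \<gamma> x k \<le> excess_cost X h xbar \<gamma>' x k" for x k
    using mult_nonneg_nonneg [OF _ gap_nonneg, of "\<gamma>' - \<gamma>" k] le
    by (simp add: excess_cost_diff [of X h xbar \<gamma>' x k \<gamma>])
  then have "feasible \<gamma>' \<subseteq> feasible \<gamma>"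
    unfolding inner_feasible_def by (auto intro: order_trans [OF diff_right_mono])
  then show "opt_cvar \<omega> \<gamma> \<le> opt_cvar \<omega> \<gamma>'"
    unfolding \<phi>_def
    by (intro cINF_superset_mono feasible_nonempty objective_bdd_below) auto
qed

text \<open>
  Raising \<open>t\<close> by \<open>\<delta> * D\<close> absorbs the growth of all excess costs, so feasibility is preserved
  at that price.
\<close>

lemma opt_cvar_add_le:
  assumes gap: "\<And>j. gap (\<xi> j) \<le> D" and \<delta>: "0 \<le> \<delta>"
  shows "opt_cvar \<omega> (\<gamma> + \<delta>) \<le> opt_cvar \<omega> \<gamma> + \<delta> * D"
proof -
  have "opt_cvar \<omega> (\<gamma> + \<delta>) - \<delta> * D \<le> objective \<omega> y" if y: "y \<in> feasible \<gamma>" for y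
  proof -
    obtain x t s where xts: "y = (x, t, s)" by (cases y)
    have shift: "excess_cost X h xbar (\<gamma> + \<delta>) x (\<xi> j) - (t + \<delta> * D)
        \<le> excess_cost X h xbar \<gamma> x (\<xi> j) - t" for j
      using mult_left_mono [OF gap \<delta>, of j]
      by (simp add: excess_cost_diff [of X h xbar "\<gamma> + \<delta>" x _ \<gamma>])
    then have "(x, t + \<delta> * D, s) \<in> feasible (\<gamma> + \<delta>)"
      using y unfolding xts inner_feasible_def by (auto intro: order_trans [OF shift])
    then have "opt_cvar \<omega> (\<gamma> + \<delta>) \<le> objective \<omega> (x, t + \<delta> * D, s)"
      unfolding \<phi>_def by (rule cINF_lower [OF objective_bdd_below])
    then show ?thesis by (simp add: xts inner_objective_def)
  qed
  then have "opt_cvar \<omega> (\<gamma> + \<delta>) - \<delta> * D \<le> opt_cvar \<omega> \<gamma>"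
    unfolding \<phi>_def by (intro cINF_greatest feasible_nonempty)
  then show ?thesis by simp
qed

lemma continuous_on_opt_cvar: "continuous_on UNIV (opt_cvar \<omega>)"
proof -
  define D where "D = (\<Sum>j\<in>UNIV. gap (\<xi> j))"
  have gap: "gap (\<xi> j) \<le> D" for j
    unfolding D_def by (rule member_le_sum [OF _ gap_nonneg]) auto
  have D: "0 \<le> D" unfolding D_def by (intro sum_nonneg gap_nonneg)
  have *: "\<bar>opt_cvar \<omega> b - opt_cvar \<omega> a\<bar> \<le> D * \<bar>b - a\<bar>" if "a \<le> b" for a b
    using opt_cvar_add_le [OF gap, of "b - a" \<omega> a] that monoD [OF opt_cvar_mono that, of \<omega>]
    by (simp add: mult.commute)
  have "D-lipschitz_on UNIV (opt_cvar \<omega>)"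
  proof (rule lipschitz_onI [OF _ D])
    fix a b :: real
    show "dist (opt_cvar \<omega> a) (opt_cvar \<omega> b) \<le> D * dist a b"
      using * [of a b] * [of b a] by (cases "a \<le> b") (simp_all add: dist_real_def abs_minus_commute)
  qed
  then show ?thesis by (rule lipschitz_on_continuous_on)
qed

lemma opt_cvar_zero_le: "opt_cvar \<omega> 0 \<le> 0"
proof -
  have "(xbar, 0, 0) \<in> feasible 0"
    using xbar by (simp add: inner_feasible_def excess_cost_def)
  then have "opt_cvar \<omega> 0 \<le> objective \<omega> (xbar, 0, 0)"
    unfolding \<phi>_def by (rule cINF_lower [OF objective_bdd_below])
  then show ?thesis by (simp add: inner_objective_def)
qed

text \<open>
  Replacing the optimal policy by \<open>x'\<close> at \<open>\<zeta> \<omega>\<close> alone changes only the term of \<open>\<omega>\<close>, as \<open>\<zeta>\<close> is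
  injective, and this term has positive weight.
\<close>

lemma policy_argmin_scenariowise:
  assumes x: "is_arg_min (\<lambda>x. worst_case (nested_CVaR_set \<zeta> \<xi> Fbar \<alpha>) X h xbar x \<gamma>)
                (\<lambda>x. x \<in> UNIV \<rightarrow> X) x"
    and x': "x' \<in> X"
  shows "excess_cvar \<omega> \<gamma> (x (\<zeta> \<omega>)) \<le> excess_cvar \<omega> \<gamma> x'"
proof -
  let ?y = "x(\<zeta> \<omega> := x')"
  have other: "(?y (\<zeta> v)) = (if v = \<omega> then x' else x (\<zeta> v))" for v
    using inj_\<zeta> by (auto dest: injD)
  have "?y \<in> UNIV \<rightarrow> X" using x x' by (auto simp: is_arg_min_linorder)
  then have "(\<Sum>v\<in>UNIV. marginal v * excess_cvar v \<gamma> (x (\<zeta> v)))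
      \<le> (\<Sum>v\<in>UNIV. marginal v * excess_cvar v \<gamma> (?y (\<zeta> v)))"
    using x unfolding is_arg_min_linorder worst_case_eq_expected_cvar by blast
  then have "marginal \<omega> * excess_cvar \<omega> \<gamma> (x (\<zeta> \<omega>)) \<le> marginal \<omega> * excess_cvar \<omega> \<gamma> x'"
    unfolding other by (simp add: sum.remove [of UNIV \<omega>])
  then show ?thesis using marginal_gt_0 by (simp add: mult_le_cancel_left_pos)
qed

lemma expected_opt_cvar_le_worst_case:
  assumes "x \<in> UNIV \<rightarrow> X"
  shows "(\<Sum>\<omega>\<in>UNIV. marginal \<omega> * opt_cvar \<omega> \<gamma>)
      \<le> worst_case (nested_CVaR_set \<zeta> \<xi> Fbar \<alpha>) X h xbar x \<gamma>"
  unfolding worst_case_eq_expected_cvar using assms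
  by (intro sum_mono mult_left_mono opt_cvar_le_excess_cvar) auto

lemma expected_opt_cvar_eq_worst_case:
  assumes x: "is_arg_min (\<lambda>x. worst_case (nested_CVaR_set \<zeta> \<xi> Fbar \<alpha>) X h xbar x \<gamma>)
                (\<lambda>x. x \<in> UNIV \<rightarrow> X) x"
  shows "worst_case (nested_CVaR_set \<zeta> \<xi> Fbar \<alpha>) X h xbar x \<gamma>
      = (\<Sum>\<omega>\<in>UNIV. marginal \<omega> * opt_cvar \<omega> \<gamma>)"
proof -
  have "x (\<zeta> \<omega>) \<in> X" for \<omega> using x by (auto simp: is_arg_min_linorder)
  then have "opt_cvar \<omega> \<gamma> = excess_cvar \<omega> \<gamma> (x (\<zeta> \<omega>))" for \<omega>
    using opt_cvar_attained policy_argmin_scenariowise [OF x] by metis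
  then show ?thesis by (simp add: worst_case_eq_expected_cvar)
qed

text \<open>
  Continuity makes the admissible \<open>\<gamma>\<close> a compact set, and it contains 0.
\<close>

lemma exists_largest_admissible_fraction:
  obtains \<gamma> where "is_arg_max (\<lambda>\<gamma>. \<gamma>)
    (\<lambda>\<gamma>. (\<Sum>\<omega>\<in>UNIV. marginal \<omega> * opt_cvar \<omega> \<gamma>) \<le> 0 \<and> 0 \<le> \<gamma> \<and> \<gamma> \<le> 1) \<gamma>"
proof -
  define S where "S = {0..1} \<inter> {\<gamma>. (\<Sum>\<omega>\<in>UNIV. marginal \<omega> * opt_cvar \<omega> \<gamma>) \<le> 0}"
  have "closed {\<gamma>. (\<Sum>\<omega>\<in>UNIV. marginal \<omega> * opt_cvar \<omega> \<gamma>) \<le> 0}"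
    by (intro closed_Collect_le continuous_intros continuous_on_opt_cvar)
  then have "compact S" unfolding S_def by (intro compact_Int_closed) auto
  moreover have "0 \<in> S"
    unfolding S_def by (auto intro!: sum_nonpos mult_nonneg_nonpos opt_cvar_zero_le)
  ultimately obtain \<gamma> where "\<gamma> \<in> S" "\<forall>\<gamma>'\<in>S. \<gamma>' \<le> \<gamma>"
    using compact_attains_sup by blast
  then show ?thesis
    by (intro that [of \<gamma>]) (auto simp: S_def is_arg_max_linorder)
qed

end

section \<open>Projections of linear systems\<close>

text \<open>
  The solution sets of linear programs with auxiliary variables, that is, projections of polyhedra,
  in the encoding of linear systems used by \<open>lp_representable_on\<close> and \<open>reduces_to_lp\<close>.
\<close>

definition lp_set :: "'a::euclidean_space set \<Rightarrow> bool" where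
  "lp_set S \<longleftrightarrow> (\<exists>m C. finite C \<and> S = fst ` lin_feasible m C)"

lemma fst_lin_feasible:
  "fst ` lin_feasible m C = {y. \<exists>u. \<forall>(a, c, b)\<in>C. a \<bullet> y + (\<Sum>j<m. c j * u j) \<le> b}"
  by (force simp: lin_feasible_def)

lemma lp_set_halfspace: "lp_set {y. a \<bullet> y \<le> b}"
  unfolding lp_set_def fst_lin_feasible
  by (rule exI [of _ 0], rule exI [of _ "{(a, \<lambda>_. 0, b)}"]) simp

lemma lp_set_UNIV: "lp_set UNIV"
  unfolding lp_set_def fst_lin_feasible
  by (rule exI [of _ 0], rule exI [of _ "{}"]) simp

text \<open>
  The two systems are put side by side, with the auxiliary variables of the second shifted past the
  \<open>m\<close> auxiliary variables of the first.
\<close>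

lemma lp_set_Int:
  assumes "lp_set S" "lp_set T"
  shows "lp_set (S \<inter> T)"
proof -
  obtain m C where C: "finite C" "S = fst ` lin_feasible m C"
    using assms(1) by (auto simp: lp_set_def)
  obtain n D where D: "finite D" "T = fst ` lin_feasible n D"
    using assms(2) by (auto simp: lp_set_def)
  define C' where "C' = (\<lambda>(a, c, b). (a, \<lambda>j. if j < m then c j else 0, b)) ` C"
  define D' where "D' = (\<lambda>(a, c, b). (a, \<lambda>j. if j < m then 0 else c (j - m), b)) ` D"
  have split: "(\<Sum>j<m + n. f j) = (\<Sum>j<m. f j) + (\<Sum>j<n. f (m + j))" for f :: "nat \<Rightarrow> real"
    by (induction n) (simp_all add: add.assoc)
  have C'_iff: "(\<forall>(a, c, b)\<in>C'. a \<bullet> y + (\<Sum>j<m + n. c j * u j) \<le> b) \<longleftrightarrow>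
      (\<forall>(a, c, b)\<in>C. a \<bullet> y + (\<Sum>j<m. c j * u j) \<le> b)" for y u
    by (simp add: C'_def split split_beta)
  have D'_iff: "(\<forall>(a, c, b)\<in>D'. a \<bullet> y + (\<Sum>j<m + n. c j * u j) \<le> b) \<longleftrightarrow>
      (\<forall>(a, c, b)\<in>D. a \<bullet> y + (\<Sum>j<n. c j * u (m + j)) \<le> b)" for y u
    by (simp add: D'_def split split_beta)
  have "S \<inter> T = fst ` lin_feasible (m + n) (C' \<union> D')"
  proof (intro equalityI subsetI)
    fix y assume "y \<in> S \<inter> T"
    then obtain u v where uv: "\<forall>(a, c, b)\<in>C. a \<bullet> y + (\<Sum>j<m. c j * u j) \<le> b"
        "\<forall>(a, c, b)\<in>D. a \<bullet> y + (\<Sum>j<n. c j * v j) \<le> b"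
      unfolding C D fst_lin_feasible by blast
    define w where "w j = (if j < m then u j else v (j - m))" for j
    have "\<forall>(a, c, b)\<in>C' \<union> D'. a \<bullet> y + (\<Sum>j<m + n. c j * w j) \<le> b"
      unfolding ball_Un C'_iff D'_iff using uv by (simp add: w_def)
    then show "y \<in> fst ` lin_feasible (m + n) (C' \<union> D')"
      unfolding fst_lin_feasible by blast
  next
    fix y assume "y \<in> fst ` lin_feasible (m + n) (C' \<union> D')"
    then obtain u where "\<forall>(a, c, b)\<in>C. a \<bullet> y + (\<Sum>j<m. c j * u j) \<le> b"
        "\<forall>(a, c, b)\<in>D. a \<bullet> y + (\<Sum>j<n. c j * u (m + j)) \<le> b"
      unfolding fst_lin_feasible mem_Collect_eq ball_Un C'_iff D'_iff by blast
    then show "y \<in> S \<inter> T"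
      unfolding C D fst_lin_feasible Int_iff mem_Collect_eq
      by (intro conjI exI [of _ u] exI [of _ "\<lambda>j. u (m + j)"])
  qed
  moreover have "finite (C' \<union> D')" using C D by (simp add: C'_def D'_def)
  ultimately show ?thesis unfolding lp_set_def by blast
qed

lemma lp_set_INT:
  assumes "finite I" "\<And>i. i \<in> I \<Longrightarrow> lp_set (S i)"
  shows "lp_set (\<Inter>i\<in>I. S i)"
  using assms by (induction I rule: finite_induct) (auto intro: lp_set_Int lp_set_UNIV)

text \<open>
  Normals are pulled back along the adjoint, which leaves the auxiliary variables untouched.
\<close>

lemma lp_set_affine_vimage:
  fixes L :: "'a::euclidean_space \<Rightarrow> 'b::euclidean_space"
  assumes "linear L" "lp_set S"
  shows "lp_set {y. L y + d \<in> S}"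
proof -
  obtain m C where C: "finite C" "S = fst ` lin_feasible m C"
    using assms(2) by (auto simp: lp_set_def)
  define C' where "C' = (\<lambda>(a, c, b). (adjoint L a, c, b - a \<bullet> d)) ` C"
  have "{y. L y + d \<in> S} = fst ` lin_feasible m C'"
    unfolding C fst_lin_feasible C'_def
    by (simp add: split_beta adjoint_clauses [OF assms(1)] inner_add_right algebra_simps)
  moreover have "finite C'" using C by (simp add: C'_def)
  ultimately show ?thesis unfolding lp_set_def by blast
qed

lemma lp_representable_on_iff: "lp_representable_on X f \<longleftrightarrow> lp_set (epigraph X f)"
  by (simp add: lp_representable_on_def lp_set_def)

lemma reduces_to_lpI:
  assumes "lp_set S" "\<And>y. y \<in> S \<Longrightarrow> f y = c \<bullet> y"
  shows "reduces_to_lp f S"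
  using assms unfolding reduces_to_lp_def lp_set_def by blast

text \<open>
  The constraint of scenario \<open>j\<close> reads \<open>h x (\<xi> j) \<le> t + s $ j + d j\<close> with a constant \<open>d j\<close>: it
  says that \<open>(x, t + s $ j + d j)\<close>, an affine image of \<open>(x, t, s)\<close>, lies in an epigraph over \<open>X\<close>.
\<close>

lemma inner_problem_reduces_to_lp:
  fixes h :: "'x::euclidean_space \<Rightarrow> 'k \<Rightarrow> real" and \<xi> :: "'j::finite \<Rightarrow> 'k"
  assumes rep: "\<And>j. lp_representable_on X (\<lambda>x. h x (\<xi> j))"
  shows "reduces_to_lp (inner_objective \<zeta> \<xi> Fbar \<alpha> \<omega>) (inner_feasible X h xbar \<xi> \<gamma>)"
proof (rule reduces_to_lpI)
  define L :: "'j \<Rightarrow> 'x \<times> real \<times> (real ^ 'j) \<Rightarrow> 'x \<times> real"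
    where "L j = (\<lambda>(x, t, s). (x, t + s $ j))" for j
  define d where "d j = (1 - \<gamma>) * h xbar (\<xi> j) + \<gamma> * (INF x'\<in>X. h x' (\<xi> j))" for j
  have lin: "linear (L j)" for j
    by (rule linearI) (auto simp: L_def algebra_simps split: prod.split)
  have "inner_feasible X h xbar \<xi> \<gamma> =
      (\<Inter>j\<in>UNIV. {y. L j y + (0, d j) \<in> epigraph X (\<lambda>x. h x (\<xi> j))}) \<inter>
      (\<Inter>j\<in>UNIV. {y. (0, 0, axis j (-1)) \<bullet> y \<le> 0})"
    by (auto simp: inner_feasible_def excess_cost_def L_def d_def epigraph_def inner_axis' algebra_simps)
  also have "lp_set \<dots>"
    using rep unfolding lp_representable_on_iff
    by (intro lp_set_Int lp_set_INT lp_set_affine_vimage lp_set_halfspace lin) auto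
  finally show "lp_set (inner_feasible X h xbar \<xi> \<gamma>)" .
next
  fix y :: "'x \<times> real \<times> (real ^ 'j)"
  show "inner_objective \<zeta> \<xi> Fbar \<alpha> \<omega> y =
      (0, 1, \<chi> j. 1 / (1 - \<alpha>) * \<P>(p in measure_pmf Fbar. snd p = \<xi> j \<bar> fst p = \<zeta> \<omega>)) \<bullet> y"
    by (cases y) (simp add: inner_objective_def inner_vec_def sum_distrib_left mult.assoc)
qed

theorem proposition2:
  fixes X :: "(real ^ 'n) set"
    and h :: "real ^ 'n \<Rightarrow> real ^ 'k \<Rightarrow> real"
    and xbar :: "real ^ 'n"
    and \<zeta> :: "'i::finite \<Rightarrow> real ^ 'z"
    and \<xi> :: "'j::finite \<Rightarrow> real ^ 'k"
    and Fbar :: "((real ^ 'z) \<times> (real ^ 'k)) pmf"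
    and \<alpha> :: real
  assumes "convex X"
    and "\<And>k. convex_on X (\<lambda>x. h x k)"
    and "xbar \<in> X"
    and "inj \<zeta>" and "inj \<xi>"
    and "set_pmf Fbar \<subseteq> range \<zeta> \<times> range \<xi>"
    and "\<And>\<omega>. \<P>(p in Fbar. fst p = \<zeta> \<omega>) > 0"
    and "0 \<le> \<alpha>" and "\<alpha> < 1"
    and "\<And>k. \<exists>x. is_arg_min (\<lambda>x. h x k) (\<lambda>x. x \<in> X) x"
    and "\<And>\<gamma>. 0 \<le> \<gamma> \<Longrightarrow> \<gamma> \<le> 1 \<Longrightarrow>
      \<exists>x. is_arg_min (\<lambda>x. worst_case (nested_CVaR_set \<zeta> \<xi> Fbar \<alpha>) X h xbar x \<gamma>)
                     (\<lambda>x. x \<in> UNIV \<rightarrow> X) x"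
  shows
    "(\<exists>x \<gamma>.
        is_arg_max (\<lambda>(x, \<gamma>). \<gamma>)
          (\<lambda>(x, \<gamma>). x \<in> UNIV \<rightarrow> X \<and>
             worst_case (nested_CVaR_set \<zeta> \<xi> Fbar \<alpha>) X h xbar x \<gamma> \<le> 0 \<and> 0 \<le> \<gamma> \<and> \<gamma> \<le> 1)
          (x, \<gamma>) \<and>
        is_arg_max (\<lambda>\<gamma>. \<gamma>)
          (\<lambda>\<gamma>. (\<Sum>\<omega>\<in>UNIV. \<P>(p in Fbar. fst p = \<zeta> \<omega>) * \<phi> X h xbar \<zeta> \<xi> Fbar \<alpha> \<omega> \<gamma>) \<le> 0 \<and>
             0 \<le> \<gamma> \<and> \<gamma> \<le> 1)
          \<gamma>) \<and>
     (\<forall>\<omega>. mono (\<phi> X h xbar \<zeta> \<xi> Fbar \<alpha> \<omega>)) \<and>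
     (\<forall>\<omega>. \<forall>\<gamma>\<in>{0..1}. \<exists>y.
        is_arg_min (inner_objective \<zeta> \<xi> Fbar \<alpha> \<omega>) (\<lambda>y. y \<in> inner_feasible X h xbar \<xi> \<gamma>) y \<and>
        \<phi> X h xbar \<zeta> \<xi> Fbar \<alpha> \<omega> \<gamma> = inner_objective \<zeta> \<xi> Fbar \<alpha> \<omega> y) \<and>
     (polyhedron X \<longrightarrow> (\<forall>\<omega>'. lp_representable_on X (\<lambda>x. h x (\<xi> \<omega>'))) \<longrightarrow>
        (\<forall>\<omega> \<gamma>. reduces_to_lp (inner_objective \<zeta> \<xi> Fbar \<alpha> \<omega>) (inner_feasible X h xbar \<xi> \<gamma>)))"
proof -
  have bdd: "bdd_below ((\<lambda>x. h x k) ` X)" for k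
    using assms(10) [of k] by (auto simp: is_arg_min_linorder intro: bdd_belowI2)
  interpret regret_problem \<zeta> \<xi> Fbar \<alpha> X h xbar
    using assms bdd by unfold_locales auto
  let ?Q = "worst_case (nested_CVaR_set \<zeta> \<xi> Fbar \<alpha>) X h xbar"
  obtain \<gamma> where \<gamma>: "is_arg_max (\<lambda>\<gamma>. \<gamma>)
      (\<lambda>\<gamma>. (\<Sum>\<omega>\<in>UNIV. marginal \<omega> * opt_cvar \<omega> \<gamma>) \<le> 0 \<and> 0 \<le> \<gamma> \<and> \<gamma> \<le> 1) \<gamma>"
    using exists_largest_admissible_fraction .
  then have "0 \<le> \<gamma>" "\<gamma> \<le> 1" by (auto simp: is_arg_max_linorder)
  then obtain x where x: "is_arg_min (\<lambda>x. ?Q x \<gamma>) (\<lambda>x. x \<in> UNIV \<rightarrow> X) x"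
    using assms(11) by blast
  have "is_arg_max (\<lambda>(x, \<gamma>). \<gamma>)
      (\<lambda>(x, \<gamma>). x \<in> UNIV \<rightarrow> X \<and> ?Q x \<gamma> \<le> 0 \<and> 0 \<le> \<gamma> \<and> \<gamma> \<le> 1) (x, \<gamma>)"
    unfolding is_arg_max_linorder
  proof (intro conjI allI impI)
    show "case (x, \<gamma>) of (x, \<gamma>) \<Rightarrow> x \<in> UNIV \<rightarrow> X \<and> ?Q x \<gamma> \<le> 0 \<and> 0 \<le> \<gamma> \<and> \<gamma> \<le> 1"
      using x \<gamma> expected_opt_cvar_eq_worst_case [OF x]
      by (simp add: is_arg_max_linorder is_arg_min_linorder)
  next
    fix y assume y: "case y of (x, \<gamma>) \<Rightarrow> x \<in> UNIV \<rightarrow> X \<and> ?Q x \<gamma> \<le> 0 \<and> 0 \<le> \<gamma> \<and> \<gamma> \<le> 1"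
    obtain x' \<gamma>' where y': "y = (x', \<gamma>')" by (cases y)
    have "(\<Sum>\<omega>\<in>UNIV. marginal \<omega> * opt_cvar \<omega> \<gamma>') \<le> 0"
      using y expected_opt_cvar_le_worst_case [of x' \<gamma>'] by (auto simp: y' intro: order_trans)
    with y \<gamma> show "(case y of (x, \<gamma>) \<Rightarrow> \<gamma>) \<le> (case (x, \<gamma>) of (x, \<gamma>) \<Rightarrow> \<gamma>)"
      by (simp add: y' is_arg_max_linorder)
  qed
  moreover have "\<exists>y. is_arg_min (objective \<omega>) (\<lambda>y. y \<in> feasible \<gamma>) y \<and> opt_cvar \<omega> \<gamma> = objective \<omega> y"
    if \<gamma>01: "\<gamma> \<in> {0..1}" for \<omega> \<gamma>
  proof -
    obtain x where x: "is_arg_min (\<lambda>x. ?Q x \<gamma>) (\<lambda>x. x \<in> UNIV \<rightarrow> X) x"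
      using assms(11) [of \<gamma>] \<gamma>01 by auto
    then have "x (\<zeta> \<omega>) \<in> X" by (auto simp: is_arg_min_linorder)
    then show ?thesis
      using opt_cvar_attained policy_argmin_scenariowise [OF x] by metis
  qed
  ultimately show ?thesis
    using \<gamma> [unfolded marginal_def]
    by (intro conjI allI ballI impI opt_cvar_mono inner_problem_reduces_to_lp
        exI [of _ x] exI [of _ \<gamma>]) auto
qed

end
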